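(* Let $\mathcal{D}$ be the free dicartesian category generated by a set $\mathcal{L}$ of propositional letters, and let $G$ be the functor from $\mathcal{D}$ to the category $\mathcal{G}$ of relations on finite ordinals (both as defined in the context). If $f,g:A\rightarrow B$ are terms of $\mathcal{D}$ and $G(f)=G(g)=\emptyset$ in $\mathcal{G}$, then $f=g$ in $\mathcal{D}$.
   Context: Formulae. Let $\mathcal{L}$ be a set, whose members are called propositional letters. The set $\mathcal{P}$ of formulae is generated from $\mathcal{L}$ and the constants $\mathrm{I}$ and $\mathrm{O}$ with the binary connectives $\times$ and $+$. Terms of $\mathcal{D}$. Each term has a type $(A,B)$, a pair of formulae of $\mathcal{P}$; we write $f:A\rightarrow B$. The atomic terms are, for all formulae $A,B$: $\mathbf{1}_A:A\rightarrow A$; $k_A:A\rightarrow\mathrm{I}$; $l_A:\mathrm{O}\rightarrow A$; $k^1_{A,B}:A\times B\rightarrow A$; $k^2_{A,B}:A\times B\rightarrow B$; $w_A:A\rightarrow A\times A$; $l^1_{A,B}:A\rightarrow A+B$; $l^2_{A,B}:B\rightarrow A+B$; $m_A:A+A\rightarrow A$. Other terms are generated by: from $f:A\rightarrow B$ and $g:B\rightarrow C$ form $g\circ f:A\rightarrow C$; from $f:A\rightarrow B$ and $g:C\rightarrow D$ form $f\times g:A\times C\rightarrow B\times D$ and $f+g:A+C\rightarrow B+D$. The category $\mathcal{D}$ (free dicartesian category generated by $\mathcal{L}$). Its objects are the formulae of $\mathcal{P}$ and its arrows are equivalence classes of terms under the smallest type-respecting equivalence relation that is a congruence for $\circ,\times,+$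 and contains all (well-typed) instances of the following equations, for $i\in\{1,2\}$; "$f=g$ in $\mathcal{D}$" means that the terms $f,g$ are equivalent. - $\mathbf{1}_B\circ f=f\circ\mathbf{1}_A=f$ for $f:A\rightarrow B$; $h\circ(g\circ f)=(h\circ g)\circ f$. - $\mathbf{1}_A\times\mathbf{1}_B=\mathbf{1}_{A\times B}$; $(g_1\circ g_2)\times(f_1\circ f_2)=(g_1\times f_1)\circ(g_2\times f_2)$; $k^i_{B_1,B_2}\circ(f_1\times f_2)=f_i\circ k^i_{A_1,A_2}$ for $f_j:A_j\rightarrow B_j$; $w_B\circ f=(f\times f)\circ w_A$ for $f:A\rightarrow B$; $k^i_{A,A}\circ w_A=\mathbf{1}_A$; $(k^1_{A,B}\times k^2_{A,B})\circ w_{A\times B}=\mathbf{1}_{A\times B}$; $f=k_A$ for every $f:A\rightarrow\mathrm{I}$; $k^1_{\mathrm{O},\mathrm{O}}=k^2_{\mathrm{O},\mathrm{O}}$. - $\mathbf{1}_A+\mathbf{1}_B=\mathbf{1}_{A+B}$; $(g_1\circ g_2)+(f_1\circ f_2)=(g_1+f_1)\circ(g_2+f_2)$; $(f_1+f_2)\circ l^i_{A_1,A_2}=l^i_{B_1,B_2}\circ f_i$ for $f_j:A_j\rightarrow B_j$; $f\circ m_A=m_B\circ(f+f)$ for $f:A\rightarrow B$; $m_A\circ l^i_{A,A}=\mathbf{1}_A$; $m_{A+B}\circ(l^1_{A,B}+l^2_{A,B})=\mathbf{1}_{A+B}$; $f=l_A$ for every $f:\mathrm{O}\rightarrow A$;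 $l^1_{\mathrm{I},\mathrm{I}}=l^2_{\mathrm{I},\mathrm{I}}$. The category $\mathcal{G}$ and the functor $G$. The objects of $\mathcal{G}$ are finite ordinals $n=\{0,\dots,n-1\}$; an arrow $n\rightarrow m$ is a binary relation, i.e. a subset of $n\times m$; identities are identity relations and composition is composition of relations. For a formula $A$ let $|A|$ be the number of occurrences of propositional letters in $A$. Put $G(A)=|A|$, and on terms: $G(\mathbf{1}_A)=\{(x,x):x\in|A|\}$; $G(k^1_{A,B})=\{(x,x):x\in|A|\}$; $G(k^2_{A,B})=\{(x+|A|,x):x\in|B|\}$; $G(w_A)=\{(x,x):x\in|A|\}\cup\{(x,x+|A|):x\in|A|\}$; $G(k_A)=\emptyset$; $G(l^1_{A,B})=\{(x,x):x\in|A|\}$; $G(l^2_{A,B})=\{(x,x+|A|):x\in|B|\}$; $G(m_A)=\{(x,x):x\in|A|\}\cup\{(x+|A|,x):x\in|A|\}$; $G(l_A)=\emptyset$; $G(g\circ f)=G(g)\circ G(f)$; and for $f:A\rightarrow B$, $g:C\rightarrow D$, $G(f\times g)=G(f+g)=G(f)\cup\{(x+|A|,y+|B|):(x,y)\in G(g)\}$. This is compatible with equality in $\mathcal{D}$ and gives a functor from $\mathcal{D}$ to $\mathcal{G}$. *)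

theory Defs
  imports Main
begin

datatype 'l fm =
    Letter 'l
  | FI
  | FO
  | FTimes "'l fm" "'l fm"  (infixr "\<^bold>\<times>" 75)
  | FPlus "'l fm" "'l fm"  (infixr "\<^bold>+" 70)

text \<open>The letters form an arbitrary set \<open>\<L>\<close> of elements of type \<open>'l\<close>, so that \<open>\<L>\<close> may be empty.\<close>

inductive_set formulae :: "'l set \<Rightarrow> 'l fm set" for \<L> :: "'l set" where
  "p \<in> \<L> \<Longrightarrow> Letter p \<in> formulae \<L>"
| "FI \<in> formulae \<L>"
| "FO \<in> formulae \<L>"
| "A \<in> formulae \<L> \<Longrightarrow> B \<in> formulae \<L> \<Longrightarrow> A \<^bold>\<times> B \<in> formulae \<L>"
| "A \<in> formulae \<L> \<Longrightarrow> B \<in> formulae \<L> \<Longrightarrow> A \<^bold>+ B \<in> formulae \<L>"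

text \<open>Raw terms carry the formula indices of their atoms; only those with a type are terms of the
  free dicartesian category.  \<open>g \<cdot> f\<close> is the composite of \<open>f\<close> followed by \<open>g\<close>.\<close>

datatype 'l trm =
    Idt "'l fm"
  | K "'l fm"
  | L "'l fm"
  | K1 "'l fm" "'l fm"
  | K2 "'l fm" "'l fm"
  | W "'l fm"
  | L1 "'l fm" "'l fm"
  | L2 "'l fm" "'l fm"
  | M "'l fm"
  | Comp "'l trm" "'l trm"  (infixr "\<cdot>" 65)
  | TTimes "'l trm" "'l trm"  (infixr "\<otimes>" 75)
  | TPlus "'l trm" "'l trm"  (infixr "\<oplus>" 70)

inductive has_type :: "'l set \<Rightarrow> 'l trm \<Rightarrow> 'l fm \<Rightarrow> 'l fm \<Rightarrow> bool"
    ("_ \<turnstile> _ \<^bold>: _ \<rightarrow> _" [51, 51, 51, 51] 50)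
  for \<L> :: "'l set" where
  ty_Idt: "A \<in> formulae \<L> \<Longrightarrow> \<L> \<turnstile> Idt A \<^bold>: A \<rightarrow> A"
| ty_K: "A \<in> formulae \<L> \<Longrightarrow> \<L> \<turnstile> K A \<^bold>: A \<rightarrow> FI"
| ty_L: "A \<in> formulae \<L> \<Longrightarrow> \<L> \<turnstile> L A \<^bold>: FO \<rightarrow> A"
| ty_K1: "A \<in> formulae \<L> \<Longrightarrow> B \<in> formulae \<L> \<Longrightarrow> \<L> \<turnstile> K1 A B \<^bold>: A \<^bold>\<times> B \<rightarrow> A"
| ty_K2: "A \<in> formulae \<L> \<Longrightarrow> B \<in> formulae \<L> \<Longrightarrow> \<L> \<turnstile> K2 A B \<^bold>: A \<^bold>\<times> B \<rightarrow> B"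
| ty_W: "A \<in> formulae \<L> \<Longrightarrow> \<L> \<turnstile> W A \<^bold>: A \<rightarrow> A \<^bold>\<times> A"
| ty_L1: "A \<in> formulae \<L> \<Longrightarrow> B \<in> formulae \<L> \<Longrightarrow> \<L> \<turnstile> L1 A B \<^bold>: A \<rightarrow> A \<^bold>+ B"
| ty_L2: "A \<in> formulae \<L> \<Longrightarrow> B \<in> formulae \<L> \<Longrightarrow> \<L> \<turnstile> L2 A B \<^bold>: B \<rightarrow> A \<^bold>+ B"
| ty_M: "A \<in> formulae \<L> \<Longrightarrow> \<L> \<turnstile> M A \<^bold>: A \<^bold>+ A \<rightarrow> A"
| ty_Comp: "\<L> \<turnstile> f \<^bold>: A \<rightarrow> B \<Longrightarrow> \<L> \<turnstile> g \<^bold>: B \<rightarrow> C \<Longrightarrow> \<L> \<turnstile> g \<cdot> f \<^bold>: A \<rightarrow> C"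
| ty_TTimes: "\<L> \<turnstile> f \<^bold>: A \<rightarrow> B \<Longrightarrow> \<L> \<turnstile> g \<^bold>: C \<rightarrow> D \<Longrightarrow> \<L> \<turnstile> f \<otimes> g \<^bold>: A \<^bold>\<times> C \<rightarrow> B \<^bold>\<times> D"
| ty_TPlus: "\<L> \<turnstile> f \<^bold>: A \<rightarrow> B \<Longrightarrow> \<L> \<turnstile> g \<^bold>: C \<rightarrow> D \<Longrightarrow> \<L> \<turnstile> f \<oplus> g \<^bold>: A \<^bold>+ C \<rightarrow> B \<^bold>+ D"

text \<open>\<open>\<L> \<turnstile> f \<approx> g \<^bold>: A \<rightarrow> B\<close> says that \<open>f\<close> and \<open>g\<close>, both of type \<open>(A, B)\<close>, are equal as arrows of
  the free dicartesian category generated by \<open>\<L>\<close>.\<close>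

inductive deq :: "'l set \<Rightarrow> 'l trm \<Rightarrow> 'l trm \<Rightarrow> 'l fm \<Rightarrow> 'l fm \<Rightarrow> bool"
    ("_ \<turnstile> _ \<approx> _ \<^bold>: _ \<rightarrow> _" [51, 51, 51, 51, 51] 50)
  for \<L> :: "'l set" where
  deq_refl: "\<L> \<turnstile> f \<^bold>: A \<rightarrow> B \<Longrightarrow> \<L> \<turnstile> f \<approx> f \<^bold>: A \<rightarrow> B"
| deq_sym: "\<L> \<turnstile> f \<approx> g \<^bold>: A \<rightarrow> B \<Longrightarrow> \<L> \<turnstile> g \<approx> f \<^bold>: A \<rightarrow> B"
| deq_trans: "\<L> \<turnstile> f \<approx> g \<^bold>: A \<rightarrow> B \<Longrightarrow> \<L> \<turnstile> g \<approx> h \<^bold>: A \<rightarrow> B \<Longrightarrow> \<L> \<turnstile> f \<approx> h \<^bold>: A \<rightarrow> B"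
| cong_Comp: "\<L> \<turnstile> f \<approx> f' \<^bold>: A \<rightarrow> B \<Longrightarrow> \<L> \<turnstile> g \<approx> g' \<^bold>: B \<rightarrow> C
    \<Longrightarrow> \<L> \<turnstile> g \<cdot> f \<approx> g' \<cdot> f' \<^bold>: A \<rightarrow> C"
| cong_TTimes: "\<L> \<turnstile> f \<approx> f' \<^bold>: A \<rightarrow> B \<Longrightarrow> \<L> \<turnstile> g \<approx> g' \<^bold>: C \<rightarrow> D
    \<Longrightarrow> \<L> \<turnstile> f \<otimes> g \<approx> f' \<otimes> g' \<^bold>: A \<^bold>\<times> C \<rightarrow> B \<^bold>\<times> D"
| cong_TPlus: "\<L> \<turnstile> f \<approx> f' \<^bold>: A \<rightarrow> B \<Longrightarrow> \<L> \<turnstile> g \<approx> g' \<^bold>: C \<rightarrow> D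
    \<Longrightarrow> \<L> \<turnstile> f \<oplus> g \<approx> f' \<oplus> g' \<^bold>: A \<^bold>+ C \<rightarrow> B \<^bold>+ D"

| id_left: "\<L> \<turnstile> f \<^bold>: A \<rightarrow> B \<Longrightarrow> \<L> \<turnstile> Idt B \<cdot> f \<approx> f \<^bold>: A \<rightarrow> B"
| id_right: "\<L> \<turnstile> f \<^bold>: A \<rightarrow> B \<Longrightarrow> \<L> \<turnstile> f \<cdot> Idt A \<approx> f \<^bold>: A \<rightarrow> B"
| assoc: "\<L> \<turnstile> f \<^bold>: A \<rightarrow> B \<Longrightarrow> \<L> \<turnstile> g \<^bold>: B \<rightarrow> C \<Longrightarrow> \<L> \<turnstile> h \<^bold>: C \<rightarrow> D
    \<Longrightarrow> \<L> \<turnstile> h \<cdot> (g \<cdot> f) \<approx> (h \<cdot> g) \<cdot> f \<^bold>: A \<rightarrow> D"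

| times_id: "A \<in> formulae \<L> \<Longrightarrow> B \<in> formulae \<L>
    \<Longrightarrow> \<L> \<turnstile> Idt A \<otimes> Idt B \<approx> Idt (A \<^bold>\<times> B) \<^bold>: A \<^bold>\<times> B \<rightarrow> A \<^bold>\<times> B"
| times_comp: "\<L> \<turnstile> g2 \<^bold>: A \<rightarrow> B \<Longrightarrow> \<L> \<turnstile> g1 \<^bold>: B \<rightarrow> C \<Longrightarrow> \<L> \<turnstile> f2 \<^bold>: A' \<rightarrow> B' \<Longrightarrow> \<L> \<turnstile> f1 \<^bold>: B' \<rightarrow> C'
    \<Longrightarrow> \<L> \<turnstile> (g1 \<cdot> g2) \<otimes> (f1 \<cdot> f2) \<approx> (g1 \<otimes> f1) \<cdot> (g2 \<otimes> f2) \<^bold>: A \<^bold>\<times> A' \<rightarrow> C \<^bold>\<times> C'"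
| K1_nat: "\<L> \<turnstile> f1 \<^bold>: A1 \<rightarrow> B1 \<Longrightarrow> \<L> \<turnstile> f2 \<^bold>: A2 \<rightarrow> B2
    \<Longrightarrow> \<L> \<turnstile> K1 B1 B2 \<cdot> (f1 \<otimes> f2) \<approx> f1 \<cdot> K1 A1 A2 \<^bold>: A1 \<^bold>\<times> A2 \<rightarrow> B1"
| K2_nat: "\<L> \<turnstile> f1 \<^bold>: A1 \<rightarrow> B1 \<Longrightarrow> \<L> \<turnstile> f2 \<^bold>: A2 \<rightarrow> B2
    \<Longrightarrow> \<L> \<turnstile> K2 B1 B2 \<cdot> (f1 \<otimes> f2) \<approx> f2 \<cdot> K2 A1 A2 \<^bold>: A1 \<^bold>\<times> A2 \<rightarrow> B2"
| W_nat: "\<L> \<turnstile> f \<^bold>: A \<rightarrow> B \<Longrightarrow> \<L> \<turnstile> W B \<cdot> f \<approx> (f \<otimes> f) \<cdot> W A \<^bold>: A \<rightarrow> B \<^bold>\<times> B"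
| K1_W: "A \<in> formulae \<L> \<Longrightarrow> \<L> \<turnstile> K1 A A \<cdot> W A \<approx> Idt A \<^bold>: A \<rightarrow> A"
| K2_W: "A \<in> formulae \<L> \<Longrightarrow> \<L> \<turnstile> K2 A A \<cdot> W A \<approx> Idt A \<^bold>: A \<rightarrow> A"
| K1_K2_W: "A \<in> formulae \<L> \<Longrightarrow> B \<in> formulae \<L>
    \<Longrightarrow> \<L> \<turnstile> (K1 A B \<otimes> K2 A B) \<cdot> W (A \<^bold>\<times> B) \<approx> Idt (A \<^bold>\<times> B) \<^bold>: A \<^bold>\<times> B \<rightarrow> A \<^bold>\<times> B"
| K_unique: "\<L> \<turnstile> f \<^bold>: A \<rightarrow> FI \<Longrightarrow> \<L> \<turnstile> f \<approx> K A \<^bold>: A \<rightarrow> FI"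
| K1_K2_FO: "\<L> \<turnstile> K1 FO FO \<approx> K2 FO FO \<^bold>: FO \<^bold>\<times> FO \<rightarrow> FO"

| plus_id: "A \<in> formulae \<L> \<Longrightarrow> B \<in> formulae \<L>
    \<Longrightarrow> \<L> \<turnstile> Idt A \<oplus> Idt B \<approx> Idt (A \<^bold>+ B) \<^bold>: A \<^bold>+ B \<rightarrow> A \<^bold>+ B"
| plus_comp: "\<L> \<turnstile> g2 \<^bold>: A \<rightarrow> B \<Longrightarrow> \<L> \<turnstile> g1 \<^bold>: B \<rightarrow> C \<Longrightarrow> \<L> \<turnstile> f2 \<^bold>: A' \<rightarrow> B' \<Longrightarrow> \<L> \<turnstile> f1 \<^bold>: B' \<rightarrow> C'
    \<Longrightarrow> \<L> \<turnstile> (g1 \<cdot> g2) \<oplus> (f1 \<cdot> f2) \<approx> (g1 \<oplus> f1) \<cdot> (g2 \<oplus> f2) \<^bold>: A \<^bold>+ A' \<rightarrow> C \<^bold>+ C'"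
| L1_nat: "\<L> \<turnstile> f1 \<^bold>: A1 \<rightarrow> B1 \<Longrightarrow> \<L> \<turnstile> f2 \<^bold>: A2 \<rightarrow> B2
    \<Longrightarrow> \<L> \<turnstile> (f1 \<oplus> f2) \<cdot> L1 A1 A2 \<approx> L1 B1 B2 \<cdot> f1 \<^bold>: A1 \<rightarrow> B1 \<^bold>+ B2"
| L2_nat: "\<L> \<turnstile> f1 \<^bold>: A1 \<rightarrow> B1 \<Longrightarrow> \<L> \<turnstile> f2 \<^bold>: A2 \<rightarrow> B2
    \<Longrightarrow> \<L> \<turnstile> (f1 \<oplus> f2) \<cdot> L2 A1 A2 \<approx> L2 B1 B2 \<cdot> f2 \<^bold>: A2 \<rightarrow> B1 \<^bold>+ B2"
| M_nat: "\<L> \<turnstile> f \<^bold>: A \<rightarrow> B \<Longrightarrow> \<L> \<turnstile> f \<cdot> M A \<approx> M B \<cdot> (f \<oplus> f) \<^bold>: A \<^bold>+ A \<rightarrow> B"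
| M_L1: "A \<in> formulae \<L> \<Longrightarrow> \<L> \<turnstile> M A \<cdot> L1 A A \<approx> Idt A \<^bold>: A \<rightarrow> A"
| M_L2: "A \<in> formulae \<L> \<Longrightarrow> \<L> \<turnstile> M A \<cdot> L2 A A \<approx> Idt A \<^bold>: A \<rightarrow> A"
| M_L1_L2: "A \<in> formulae \<L> \<Longrightarrow> B \<in> formulae \<L>
    \<Longrightarrow> \<L> \<turnstile> M (A \<^bold>+ B) \<cdot> (L1 A B \<oplus> L2 A B) \<approx> Idt (A \<^bold>+ B) \<^bold>: A \<^bold>+ B \<rightarrow> A \<^bold>+ B"
| L_unique: "\<L> \<turnstile> f \<^bold>: FO \<rightarrow> A \<Longrightarrow> \<L> \<turnstile> f \<approx> L A \<^bold>: FO \<rightarrow> A"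
| L1_L2_FI: "\<L> \<turnstile> L1 FI FI \<approx> L2 FI FI \<^bold>: FI \<rightarrow> FI \<^bold>+ FI"

primrec lcount :: "'l fm \<Rightarrow> nat" where
  "lcount (Letter p) = 1"
| "lcount FI = 0"
| "lcount FO = 0"
| "lcount (A \<^bold>\<times> B) = lcount A + lcount B"
| "lcount (A \<^bold>+ B) = lcount A + lcount B"

primrec src :: "'l trm \<Rightarrow> 'l fm" where
  "src (Idt A) = A"
| "src (K A) = A"
| "src (L A) = FO"
| "src (K1 A B) = A \<^bold>\<times> B"
| "src (K2 A B) = A \<^bold>\<times> B"
| "src (W A) = A"
| "src (L1 A B) = A"
| "src (L2 A B) = B"
| "src (M A) = A \<^bold>+ A"
| "src (g \<cdot> f) = src f"
| "src (f \<otimes> g) = src f \<^bold>\<times> src g"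
| "src (f \<oplus> g) = src f \<^bold>+ src g"

primrec tgt :: "'l trm \<Rightarrow> 'l fm" where
  "tgt (Idt A) = A"
| "tgt (K A) = FI"
| "tgt (L A) = A"
| "tgt (K1 A B) = A"
| "tgt (K2 A B) = B"
| "tgt (W A) = A \<^bold>\<times> A"
| "tgt (L1 A B) = A \<^bold>+ B"
| "tgt (L2 A B) = A \<^bold>+ B"
| "tgt (M A) = A"
| "tgt (g \<cdot> f) = tgt g"
| "tgt (f \<otimes> g) = tgt f \<^bold>\<times> tgt g"
| "tgt (f \<oplus> g) = tgt f \<^bold>+ tgt g"

lemma has_type_src_tgt: "\<L> \<turnstile> f \<^bold>: A \<rightarrow> B \<Longrightarrow> src f = A \<and> tgt f = B"
  by (induction rule: has_type.induct) auto

lemma has_type_formulae: "\<L> \<turnstile> f \<^bold>: A \<rightarrow> B \<Longrightarrow> A \<in> formulae \<L> \<and> B \<in> formulae \<L>"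
  by (induction rule: has_type.induct) (auto intro: formulae.intros)

lemma deq_has_type: "\<L> \<turnstile> f \<approx> g \<^bold>: A \<rightarrow> B \<Longrightarrow> \<L> \<turnstile> f \<^bold>: A \<rightarrow> B \<and> \<L> \<turnstile> g \<^bold>: A \<rightarrow> B"
  by (induction rule: deq.induct)
    (blast intro: has_type.intros formulae.intros dest: has_type_formulae)+

text \<open>An arrow from \<open>n\<close> to \<open>m\<close> in the category of relations on finite ordinals is represented by its
  graph, a subset of \<open>{..<n} \<times> {..<m}\<close>; see \<open>G_subset\<close>.  The library composite
  \<open>r O s\<close> is \<open>r\<close> followed by \<open>s\<close>.\<close>

primrec G :: "'l trm \<Rightarrow> (nat \<times> nat) set" where
  "G (Idt A) = {(x, x) | x. x < lcount A}"
| "G (K A) = {}"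
| "G (L A) = {}"
| "G (K1 A B) = {(x, x) | x. x < lcount A}"
| "G (K2 A B) = {(x + lcount A, x) | x. x < lcount B}"
| "G (W A) = {(x, x) | x. x < lcount A} \<union> {(x, x + lcount A) | x. x < lcount A}"
| "G (L1 A B) = {(x, x) | x. x < lcount A}"
| "G (L2 A B) = {(x, x + lcount A) | x. x < lcount B}"
| "G (M A) = {(x, x) | x. x < lcount A} \<union> {(x + lcount A, x) | x. x < lcount A}"
| "G (g \<cdot> f) = G f O G g"
| "G (f \<otimes> g) = G f \<union> {(x + lcount (src f), y + lcount (tgt f)) | x y. (x, y) \<in> G g}"
| "G (f \<oplus> g) = G f \<union> {(x + lcount (src f), y + lcount (tgt f)) | x y. (x, y) \<in> G g}"

lemma G_subset: "\<L> \<turnstile> f \<^bold>: A \<rightarrow> B \<Longrightarrow> G f \<subseteq> {..<lcount A} \<times> {..<lcount B}"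
  by (induction rule: has_type.induct) (fastforce dest: has_type_src_tgt)+

end

(* Normal forms (cut-free terms) are built from identities on letters, k, l, projections on the
  right, injections on the left, pairs and copairs; permuting cuts shows that every term equals
  one of them.  By induction on the normal form, a term with empty graph factors through O or
  through I.  The equation k1 = k2 on O x O says that there is at most one arrow A -> O, and dually
  there is at most one arrow I -> B; so there is at most one arrow A -> B that factors through O, at
  most one that factors through I, and the two agree whenever both exist. *)

theory Submission
  imports Defs
begin

text \<open>A direct induction on terms breaks down at composition, because a composite of two
  nonempty relations may be empty. With p a letter, pair the identity of p with p -> I -> p + I to
  get an arrow p -> p x (p + I), and follow it by the second projection: both graphs are nonempty,
  yet the composite has an empty graph. This is why cuts are removed before graphs are inspected: in
  a normal form every immediate subterm in normal form inherits an empty graph. The second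
  difficulty is a pair with one component factoring through O and the other through I, and likewise
  a copair. It is settled by a case distinction on formulae rather than on terms: once a single
  arrow from the common source to O exists, every arrow through I also factors through O, and dually
  for a common target and an arrow out of I.\<close>

section \<open>Invariance of the graph under equality of arrows\<close>

lemma G_bound:
  "\<L> \<turnstile> f \<^bold>: A \<rightarrow> B \<Longrightarrow> (x, y) \<in> G f \<Longrightarrow> x < lcount A \<and> y < lcount B"
  using G_subset by fastforce

text \<open>The bounds on graphs keep the unshifted block and the shifted block apart, so no new
  pair arises by passing from one block to the other at the middle object. Since \<open>G\<close>
  treats \<open>\<otimes>\<close> and \<open>\<oplus>\<close> alike, this computation also settles
  the equation for \<open>\<oplus>\<close>.\<close>

lemma G_TTimes_comp:
  assumes f: "\<L> \<turnstile> f \<^bold>: A \<rightarrow> B" and g: "\<L> \<turnstile> g \<^bold>: B \<rightarrow> C"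
    and f': "\<L> \<turnstile> f' \<^bold>: A' \<rightarrow> B'" and g': "\<L> \<turnstile> g' \<^bold>: B' \<rightarrow> C'"
  shows "G ((g \<cdot> f) \<otimes> (g' \<cdot> f')) = G ((g \<otimes> g') \<cdot> (f \<otimes> f'))"
  using assms[THEN has_type_src_tgt]
  by (auto simp: relcomp_unfold dest: G_bound[OF f] G_bound[OF g] G_bound[OF f'] G_bound[OF g'])

text \<open>This soundness result has two uses: it carries emptiness of the graph from a term to its
  normal form, and from a pair or copair to its components.\<close>

lemma deq_imp_G_eq:
  assumes "\<L> \<turnstile> f \<approx> g \<^bold>: A \<rightarrow> B"
  shows "G f = G g"
  using assms
proof (induction rule: deq.induct)
  \<comment> \<open>Equal graphs of the factors are not enough here: the shift is read off from
    \<open>src\<close> and \<open>tgt\<close> of the first factor, which agree because equal arrows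
    have the same type.\<close>
  case (cong_TTimes f f' A B g g' C D)
  then show ?case by (auto dest!: deq_has_type has_type_src_tgt)
next
  case (cong_TPlus f f' A B g g' C D)
  then show ?case by (auto dest!: deq_has_type has_type_src_tgt)
next
  case (times_comp g2 A B g1 C f2 A' B' f1 C')
  then show ?case by (rule G_TTimes_comp)
next
  case (plus_comp g2 A B g1 C f2 A' B' f1 C')
  from G_TTimes_comp[OF plus_comp] show ?case by simp
next
  case (id_left f A B)
  then show ?case by (auto dest: G_bound)
next
  case (id_right f A B)
  then show ?case by (auto dest: G_bound)
next
  case (times_id A B)
  show ?case by auto presburger
next
  case (plus_id A B)
  show ?case by auto presburger
next
  case (K1_nat f1 A1 B1 f2 A2 B2)
  from this[THEN has_type_src_tgt] show ?case
    by (auto simp: relcomp_unfold dest: K1_nat[THEN G_bound])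
next
  case (K2_nat f1 A1 B1 f2 A2 B2)
  from this[THEN has_type_src_tgt] show ?case
    by (auto simp: relcomp_unfold dest: K2_nat[THEN G_bound])
next
  case (L1_nat f1 A1 B1 f2 A2 B2)
  from this[THEN has_type_src_tgt] show ?case
    by (auto simp: relcomp_unfold dest: L1_nat[THEN G_bound])
next
  case (L2_nat f1 A1 B1 f2 A2 B2)
  from this[THEN has_type_src_tgt] show ?case
    by (auto simp: relcomp_unfold dest: L2_nat[THEN G_bound])
next
  case (W_nat f A B)
  from this[THEN has_type_src_tgt] show ?case
    by (auto simp: relcomp_unfold dest: W_nat[THEN G_bound])
next
  case (M_nat f A B)
  then have [simp]: "src f = A" "tgt f = B" by (auto dest: has_type_src_tgt)
  show ?case
    by (auto simp: relcomp_unfold dest: M_nat[THEN G_bound])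
next
  case (K1_K2_W A B)
  show ?case
  proof (intro equalityI subrelI)
    fix x y
    assume "(x, y) \<in> G (Idt (A \<^bold>\<times> B))"
    then have xy: "y = x" "x < lcount A + lcount B" by auto
    \<comment> \<open>\<open>W\<close> sends \<open>x\<close> to two copies of itself, at distance
      \<open>lcount A + lcount B\<close>. \<open>K1\<close> keeps the part in \<open>A\<close> of
      the first copy and \<open>K2\<close> the part in \<open>B\<close> of the second, so exactly
      one copy survives.\<close>
    define z where "z = (if x < lcount A then x else x + (lcount A + lcount B))"
    have "(x, z) \<in> G (W (A \<^bold>\<times> B))" and "(z, y) \<in> G (K1 A B \<otimes> K2 A B)"
      using xy by (auto simp: z_def intro: exI[of _ "x - lcount A"])
    then show "(x, y) \<in> G ((K1 A B \<otimes> K2 A B) \<cdot> W (A \<^bold>\<times> B))" by auto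
  qed auto
next
  case (M_L1_L2 A B)
  show ?case
  proof (intro equalityI subrelI)
    fix x y
    assume "(x, y) \<in> G (Idt (A \<^bold>+ B))"
    then have xy: "y = x" "x < lcount A + lcount B" by auto
    \<comment> \<open>The mirror image: a position in \<open>A\<close> lands in the first copy of
      the sum, a position in \<open>B\<close> in the second, and \<open>M\<close> folds both back to
      \<open>x\<close>.\<close>
    define z where "z = (if x < lcount A then x else x + (lcount A + lcount B))"
    have "(x, z) \<in> G (L1 A B \<oplus> L2 A B)" and "(z, y) \<in> G (M (A \<^bold>+ B))"
      using xy by (auto simp: z_def intro: exI[of _ "x - lcount A"])
    then show "(x, y) \<in> G (M (A \<^bold>+ B) \<cdot> (L1 A B \<oplus> L2 A B))" by auto
  qed auto
next
  case (K_unique f A)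
  then show ?case by (auto dest: G_bound)
next
  case (L_unique f A)
  then show ?case by (auto dest: G_bound)
qed (auto simp: O_assoc)

section \<open>Pairs and copairs in the equational calculus\<close>

text \<open>\<open>deq\<close> with the right-hand term as last argument, so that \<open>\<dots>\<close> can refer to it in calculations.\<close>

definition hom_eq :: "'l set \<Rightarrow> 'l fm \<Rightarrow> 'l fm \<Rightarrow> 'l trm \<Rightarrow> 'l trm \<Rightarrow> bool"
    ("_ \<turnstile> \<langle>_, _\<rangle> _ \<simeq> _" [51, 0, 0, 51, 51] 50)
  where "\<L> \<turnstile> \<langle>A, B\<rangle> f \<simeq> g \<longleftrightarrow> \<L> \<turnstile> f \<approx> g \<^bold>: A \<rightarrow> B"

lemma hom_eq_trans [trans]:
  "\<L> \<turnstile> \<langle>A, B\<rangle> f \<simeq> g \<Longrightarrow> \<L> \<turnstile> \<langle>A, B\<rangle> g \<simeq> h \<Longrightarrow> \<L> \<turnstile> \<langle>A, B\<rangle> f \<simeq> h"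
  unfolding hom_eq_def by (rule deq_trans)

lemmas typing = has_type.intros formulae.intros

lemma comp_assoc:
  "\<L> \<turnstile> f \<^bold>: A \<rightarrow> B \<Longrightarrow> \<L> \<turnstile> g \<^bold>: B \<rightarrow> C \<Longrightarrow> \<L> \<turnstile> h \<^bold>: C \<rightarrow> D
    \<Longrightarrow> \<L> \<turnstile> (h \<cdot> g) \<cdot> f \<approx> h \<cdot> (g \<cdot> f) \<^bold>: A \<rightarrow> D"
  by (rule deq_sym) (rule assoc)

lemma comp_left:
  "\<L> \<turnstile> f \<approx> f' \<^bold>: A \<rightarrow> B \<Longrightarrow> \<L> \<turnstile> g \<^bold>: B \<rightarrow> C \<Longrightarrow> \<L> \<turnstile> g \<cdot> f \<approx> g \<cdot> f' \<^bold>: A \<rightarrow> C"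
  by (blast intro: cong_Comp deq_refl)

lemma comp_right:
  "\<L> \<turnstile> g \<approx> g' \<^bold>: B \<rightarrow> C \<Longrightarrow> \<L> \<turnstile> f \<^bold>: A \<rightarrow> B \<Longrightarrow> \<L> \<turnstile> g \<cdot> f \<approx> g' \<cdot> f \<^bold>: A \<rightarrow> C"
  by (blast intro: cong_Comp deq_refl)

text \<open>The term \<open>(f \<otimes> g) \<cdot> W C\<close> is the pairing of \<open>f\<close>
  and \<open>g\<close>. Naturality of the projection brings \<open>f\<close> in front of
  \<open>K1 C C \<cdot> W C\<close>, which is an identity. Dually,
  \<open>M C \<cdot> (f \<oplus> g)\<close> is the copairing.\<close>

lemma K1_pair:
  assumes f: "\<L> \<turnstile> f \<^bold>: C \<rightarrow> A" and g: "\<L> \<turnstile> g \<^bold>: C \<rightarrow> B"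
  shows "\<L> \<turnstile> K1 A B \<cdot> ((f \<otimes> g) \<cdot> W C) \<approx> f \<^bold>: C \<rightarrow> A"
proof -
  note ty = typing f g
  have fm: "A \<in> formulae \<L>" "B \<in> formulae \<L>" "C \<in> formulae \<L>"
    using assms has_type_formulae by blast+
  have "\<L> \<turnstile> \<langle>C, A\<rangle> K1 A B \<cdot> ((f \<otimes> g) \<cdot> W C) \<simeq> (K1 A B \<cdot> (f \<otimes> g)) \<cdot> W C"
    unfolding hom_eq_def by (blast intro: assoc ty fm)
  also have "\<L> \<turnstile> \<langle>C, A\<rangle> \<dots> \<simeq> (f \<cdot> K1 C C) \<cdot> W C"
    unfolding hom_eq_def by (blast intro: comp_right K1_nat ty fm)
  also have "\<L> \<turnstile> \<langle>C, A\<rangle> \<dots> \<simeq> f \<cdot> (K1 C C \<cdot> W C)"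
    unfolding hom_eq_def by (blast intro: comp_assoc ty fm)
  also have "\<L> \<turnstile> \<langle>C, A\<rangle> \<dots> \<simeq> f \<cdot> Idt C"
    unfolding hom_eq_def by (blast intro: comp_left K1_W ty fm)
  also have "\<L> \<turnstile> \<langle>C, A\<rangle> \<dots> \<simeq> f"
    unfolding hom_eq_def by (rule id_right[OF f])
  finally show ?thesis unfolding hom_eq_def .
qed

lemma K2_pair:
  assumes f: "\<L> \<turnstile> f \<^bold>: C \<rightarrow> A" and g: "\<L> \<turnstile> g \<^bold>: C \<rightarrow> B"
  shows "\<L> \<turnstile> K2 A B \<cdot> ((f \<otimes> g) \<cdot> W C) \<approx> g \<^bold>: C \<rightarrow> B"
proof -
  note ty = typing f g
  have fm: "A \<in> formulae \<L>" "B \<in> formulae \<L>" "C \<in> formulae \<L>"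
    using assms has_type_formulae by blast+
  have "\<L> \<turnstile> \<langle>C, B\<rangle> K2 A B \<cdot> ((f \<otimes> g) \<cdot> W C) \<simeq> (K2 A B \<cdot> (f \<otimes> g)) \<cdot> W C"
    unfolding hom_eq_def by (blast intro: assoc ty fm)
  also have "\<L> \<turnstile> \<langle>C, B\<rangle> \<dots> \<simeq> (g \<cdot> K2 C C) \<cdot> W C"
    unfolding hom_eq_def by (blast intro: comp_right K2_nat ty fm)
  also have "\<L> \<turnstile> \<langle>C, B\<rangle> \<dots> \<simeq> g \<cdot> (K2 C C \<cdot> W C)"
    unfolding hom_eq_def by (blast intro: comp_assoc ty fm)
  also have "\<L> \<turnstile> \<langle>C, B\<rangle> \<dots> \<simeq> g \<cdot> Idt C"
    unfolding hom_eq_def by (blast intro: comp_left K2_W ty fm)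
  also have "\<L> \<turnstile> \<langle>C, B\<rangle> \<dots> \<simeq> g"
    unfolding hom_eq_def by (rule id_right[OF g])
  finally show ?thesis unfolding hom_eq_def .
qed

lemma copair_L1:
  assumes f: "\<L> \<turnstile> f \<^bold>: A \<rightarrow> C" and g: "\<L> \<turnstile> g \<^bold>: B \<rightarrow> C"
  shows "\<L> \<turnstile> (M C \<cdot> (f \<oplus> g)) \<cdot> L1 A B \<approx> f \<^bold>: A \<rightarrow> C"
proof -
  note ty = typing f g
  have fm: "A \<in> formulae \<L>" "B \<in> formulae \<L>" "C \<in> formulae \<L>"
    using assms has_type_formulae by blast+
  have "\<L> \<turnstile> \<langle>A, C\<rangle> (M C \<cdot> (f \<oplus> g)) \<cdot> L1 A B \<simeq> M C \<cdot> ((f \<oplus> g) \<cdot> L1 A B)"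
    unfolding hom_eq_def by (blast intro: comp_assoc ty fm)
  also have "\<L> \<turnstile> \<langle>A, C\<rangle> \<dots> \<simeq> M C \<cdot> (L1 C C \<cdot> f)"
    unfolding hom_eq_def by (blast intro: comp_left L1_nat ty fm)
  also have "\<L> \<turnstile> \<langle>A, C\<rangle> \<dots> \<simeq> (M C \<cdot> L1 C C) \<cdot> f"
    unfolding hom_eq_def by (blast intro: assoc ty fm)
  also have "\<L> \<turnstile> \<langle>A, C\<rangle> \<dots> \<simeq> Idt C \<cdot> f"
    unfolding hom_eq_def by (blast intro: comp_right M_L1 ty fm)
  also have "\<L> \<turnstile> \<langle>A, C\<rangle> \<dots> \<simeq> f"
    unfolding hom_eq_def by (rule id_left[OF f])
  finally show ?thesis unfolding hom_eq_def .
qed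

lemma copair_L2:
  assumes f: "\<L> \<turnstile> f \<^bold>: A \<rightarrow> C" and g: "\<L> \<turnstile> g \<^bold>: B \<rightarrow> C"
  shows "\<L> \<turnstile> (M C \<cdot> (f \<oplus> g)) \<cdot> L2 A B \<approx> g \<^bold>: B \<rightarrow> C"
proof -
  note ty = typing f g
  have fm: "A \<in> formulae \<L>" "B \<in> formulae \<L>" "C \<in> formulae \<L>"
    using assms has_type_formulae by blast+
  have "\<L> \<turnstile> \<langle>B, C\<rangle> (M C \<cdot> (f \<oplus> g)) \<cdot> L2 A B \<simeq> M C \<cdot> ((f \<oplus> g) \<cdot> L2 A B)"
    unfolding hom_eq_def by (blast intro: comp_assoc ty fm)
  also have "\<L> \<turnstile> \<langle>B, C\<rangle> \<dots> \<simeq> M C \<cdot> (L2 C C \<cdot> g)"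
    unfolding hom_eq_def by (blast intro: comp_left L2_nat ty fm)
  also have "\<L> \<turnstile> \<langle>B, C\<rangle> \<dots> \<simeq> (M C \<cdot> L2 C C) \<cdot> g"
    unfolding hom_eq_def by (blast intro: assoc ty fm)
  also have "\<L> \<turnstile> \<langle>B, C\<rangle> \<dots> \<simeq> Idt C \<cdot> g"
    unfolding hom_eq_def by (blast intro: comp_right M_L2 ty fm)
  also have "\<L> \<turnstile> \<langle>B, C\<rangle> \<dots> \<simeq> g"
    unfolding hom_eq_def by (rule id_left[OF g])
  finally show ?thesis unfolding hom_eq_def .
qed

text \<open>Naturality of \<open>W\<close> lets \<open>h\<close> pass through the diagonal. This is
  the step that moves a cut above a pair.\<close>

lemma pair_comp:
  assumes f: "\<L> \<turnstile> f \<^bold>: C \<rightarrow> A" and g: "\<L> \<turnstile> g \<^bold>: C \<rightarrow> B" and h: "\<L> \<turnstile> h \<^bold>: D \<rightarrow> C"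
  shows "\<L> \<turnstile> ((f \<cdot> h) \<otimes> (g \<cdot> h)) \<cdot> W D \<approx> ((f \<otimes> g) \<cdot> W C) \<cdot> h \<^bold>: D \<rightarrow> A \<^bold>\<times> B"
proof -
  note ty = typing f g h
  have fm: "C \<in> formulae \<L>" "D \<in> formulae \<L>"
    using assms has_type_formulae by blast+
  have "\<L> \<turnstile> \<langle>D, A \<^bold>\<times> B\<rangle> ((f \<cdot> h) \<otimes> (g \<cdot> h)) \<cdot> W D \<simeq> ((f \<otimes> g) \<cdot> (h \<otimes> h)) \<cdot> W D"
    unfolding hom_eq_def by (blast intro: comp_right times_comp ty fm)
  also have "\<L> \<turnstile> \<langle>D, A \<^bold>\<times> B\<rangle> \<dots> \<simeq> (f \<otimes> g) \<cdot> ((h \<otimes> h) \<cdot> W D)"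
    unfolding hom_eq_def by (blast intro: comp_assoc ty fm)
  also have "\<L> \<turnstile> \<langle>D, A \<^bold>\<times> B\<rangle> \<dots> \<simeq> (f \<otimes> g) \<cdot> (W C \<cdot> h)"
    unfolding hom_eq_def by (blast intro: comp_left W_nat[THEN deq_sym] ty fm)
  also have "\<L> \<turnstile> \<langle>D, A \<^bold>\<times> B\<rangle> \<dots> \<simeq> ((f \<otimes> g) \<cdot> W C) \<cdot> h"
    unfolding hom_eq_def by (blast intro: assoc ty fm)
  finally show ?thesis unfolding hom_eq_def .
qed

lemma comp_copair:
  assumes f: "\<L> \<turnstile> f \<^bold>: A \<rightarrow> C" and g: "\<L> \<turnstile> g \<^bold>: B \<rightarrow> C" and h: "\<L> \<turnstile> h \<^bold>: C \<rightarrow> D"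
  shows "\<L> \<turnstile> M D \<cdot> ((h \<cdot> f) \<oplus> (h \<cdot> g)) \<approx> h \<cdot> (M C \<cdot> (f \<oplus> g)) \<^bold>: A \<^bold>+ B \<rightarrow> D"
proof -
  note ty = typing f g h
  have fm: "C \<in> formulae \<L>" "D \<in> formulae \<L>"
    using assms has_type_formulae by blast+
  have "\<L> \<turnstile> \<langle>A \<^bold>+ B, D\<rangle> M D \<cdot> ((h \<cdot> f) \<oplus> (h \<cdot> g)) \<simeq> M D \<cdot> ((h \<oplus> h) \<cdot> (f \<oplus> g))"
    unfolding hom_eq_def by (blast intro: comp_left plus_comp ty fm)
  also have "\<L> \<turnstile> \<langle>A \<^bold>+ B, D\<rangle> \<dots> \<simeq> (M D \<cdot> (h \<oplus> h)) \<cdot> (f \<oplus> g)"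
    unfolding hom_eq_def by (blast intro: assoc ty fm)
  also have "\<L> \<turnstile> \<langle>A \<^bold>+ B, D\<rangle> \<dots> \<simeq> (h \<cdot> M C) \<cdot> (f \<oplus> g)"
    unfolding hom_eq_def by (blast intro: comp_right M_nat[THEN deq_sym] ty fm)
  also have "\<L> \<turnstile> \<langle>A \<^bold>+ B, D\<rangle> \<dots> \<simeq> h \<cdot> (M C \<cdot> (f \<oplus> g))"
    unfolding hom_eq_def by (blast intro: comp_assoc ty fm)
  finally show ?thesis unfolding hom_eq_def .
qed

text \<open>Pulling \<open>f \<otimes> g\<close> out leaves the pair of the two projections, an
  identity. Products of terms are thereby reduced to pairs and projections, the only product
  operations of normal forms.\<close>

lemma pair_projections:
  assumes f: "\<L> \<turnstile> f \<^bold>: A \<rightarrow> B" and g: "\<L> \<turnstile> g \<^bold>: C \<rightarrow> D"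
  shows "\<L> \<turnstile> ((f \<cdot> K1 A C) \<otimes> (g \<cdot> K2 A C)) \<cdot> W (A \<^bold>\<times> C) \<approx> f \<otimes> g \<^bold>: A \<^bold>\<times> C \<rightarrow> B \<^bold>\<times> D"
proof -
  note ty = typing f g
  have fm: "A \<in> formulae \<L>" "C \<in> formulae \<L>"
    using assms has_type_formulae by blast+
  have "\<L> \<turnstile> \<langle>A \<^bold>\<times> C, B \<^bold>\<times> D\<rangle> ((f \<cdot> K1 A C) \<otimes> (g \<cdot> K2 A C)) \<cdot> W (A \<^bold>\<times> C)
      \<simeq> ((f \<otimes> g) \<cdot> (K1 A C \<otimes> K2 A C)) \<cdot> W (A \<^bold>\<times> C)"
    unfolding hom_eq_def by (blast intro: comp_right times_comp ty fm)
  also have "\<L> \<turnstile> \<langle>A \<^bold>\<times> C, B \<^bold>\<times> D\<rangle> \<dots> \<simeq> (f \<otimes> g) \<cdot> ((K1 A C \<otimes> K2 A C) \<cdot> W (A \<^bold>\<times> C))"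
    unfolding hom_eq_def by (blast intro: comp_assoc ty fm)
  also have "\<L> \<turnstile> \<langle>A \<^bold>\<times> C, B \<^bold>\<times> D\<rangle> \<dots> \<simeq> (f \<otimes> g) \<cdot> Idt (A \<^bold>\<times> C)"
    unfolding hom_eq_def by (blast intro: comp_left K1_K2_W ty fm)
  also have "\<L> \<turnstile> \<langle>A \<^bold>\<times> C, B \<^bold>\<times> D\<rangle> \<dots> \<simeq> f \<otimes> g"
    unfolding hom_eq_def by (blast intro: id_right ty fm)
  finally show ?thesis unfolding hom_eq_def .
qed

lemma copair_injections:
  assumes f: "\<L> \<turnstile> f \<^bold>: A \<rightarrow> B" and g: "\<L> \<turnstile> g \<^bold>: C \<rightarrow> D"
  shows "\<L> \<turnstile> M (B \<^bold>+ D) \<cdot> ((L1 B D \<cdot> f) \<oplus> (L2 B D \<cdot> g)) \<approx> f \<oplus> g \<^bold>: A \<^bold>+ C \<rightarrow> B \<^bold>+ D"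
proof -
  note ty = typing f g
  have fm: "B \<in> formulae \<L>" "D \<in> formulae \<L>"
    using assms has_type_formulae by blast+
  have "\<L> \<turnstile> \<langle>A \<^bold>+ C, B \<^bold>+ D\<rangle> M (B \<^bold>+ D) \<cdot> ((L1 B D \<cdot> f) \<oplus> (L2 B D \<cdot> g))
      \<simeq> M (B \<^bold>+ D) \<cdot> ((L1 B D \<oplus> L2 B D) \<cdot> (f \<oplus> g))"
    unfolding hom_eq_def by (blast intro: comp_left plus_comp ty fm)
  also have "\<L> \<turnstile> \<langle>A \<^bold>+ C, B \<^bold>+ D\<rangle> \<dots> \<simeq> (M (B \<^bold>+ D) \<cdot> (L1 B D \<oplus> L2 B D)) \<cdot> (f \<oplus> g)"
    unfolding hom_eq_def by (blast intro: assoc ty fm)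
  also have "\<L> \<turnstile> \<langle>A \<^bold>+ C, B \<^bold>+ D\<rangle> \<dots> \<simeq> Idt (B \<^bold>+ D) \<cdot> (f \<oplus> g)"
    unfolding hom_eq_def by (blast intro: comp_right M_L1_L2 ty fm)
  also have "\<L> \<turnstile> \<langle>A \<^bold>+ C, B \<^bold>+ D\<rangle> \<dots> \<simeq> f \<oplus> g"
    unfolding hom_eq_def by (blast intro: id_left ty fm)
  finally show ?thesis unfolding hom_eq_def .
qed

section \<open>Uniqueness of arrows into O and out of I\<close>

text \<open>Precomposing the two equal projections of O x O with the pair of \<open>f\<close> and
  \<open>g\<close> returns \<open>f\<close> on one side and \<open>g\<close> on the other.\<close>

lemma into_FO_unique:
  assumes f: "\<L> \<turnstile> f \<^bold>: A \<rightarrow> FO" and g: "\<L> \<turnstile> g \<^bold>: A \<rightarrow> FO"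
  shows "\<L> \<turnstile> f \<approx> g \<^bold>: A \<rightarrow> FO"
proof -
  have "\<L> \<turnstile> (f \<otimes> g) \<cdot> W A \<^bold>: A \<rightarrow> FO \<^bold>\<times> FO"
    using f g has_type_formulae by (blast intro: typing)
  from comp_right[OF K1_K2_FO this] K1_pair[OF f g] K2_pair[OF f g] show ?thesis
    by (blast intro: deq_sym deq_trans)
qed

lemma from_FI_unique:
  assumes f: "\<L> \<turnstile> f \<^bold>: FI \<rightarrow> A" and g: "\<L> \<turnstile> g \<^bold>: FI \<rightarrow> A"
  shows "\<L> \<turnstile> f \<approx> g \<^bold>: FI \<rightarrow> A"
proof -
  have "\<L> \<turnstile> M A \<cdot> (f \<oplus> g) \<^bold>: FI \<^bold>+ FI \<rightarrow> A"
    using f g has_type_formulae by (blast intro: typing)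
  from comp_left[OF L1_L2_FI this] copair_L1[OF f g] copair_L2[OF f g] show ?thesis
    by (blast intro: deq_sym deq_trans)
qed

section \<open>Normal forms and cut elimination\<close>

text \<open>These are the cut-free rules of a sequent calculus with one formula on each side.
  Identities occur on letters only, so the graph of such an identity is never empty.\<close>

inductive nf :: "'l set \<Rightarrow> 'l trm \<Rightarrow> 'l fm \<Rightarrow> 'l fm \<Rightarrow> bool" for \<L> :: "'l set" where
  nf_Idt: "p \<in> \<L> \<Longrightarrow> nf \<L> (Idt (Letter p)) (Letter p) (Letter p)"
| nf_K: "A \<in> formulae \<L> \<Longrightarrow> nf \<L> (K A) A FI"
| nf_L: "A \<in> formulae \<L> \<Longrightarrow> nf \<L> (L A) FO A"
| nf_K1: "nf \<L> f A C \<Longrightarrow> B \<in> formulae \<L> \<Longrightarrow> nf \<L> (f \<cdot> K1 A B) (A \<^bold>\<times> B) C"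
| nf_K2: "nf \<L> f B C \<Longrightarrow> A \<in> formulae \<L> \<Longrightarrow> nf \<L> (f \<cdot> K2 A B) (A \<^bold>\<times> B) C"
| nf_L1: "nf \<L> f C A \<Longrightarrow> B \<in> formulae \<L> \<Longrightarrow> nf \<L> (L1 A B \<cdot> f) C (A \<^bold>+ B)"
| nf_L2: "nf \<L> f C B \<Longrightarrow> A \<in> formulae \<L> \<Longrightarrow> nf \<L> (L2 A B \<cdot> f) C (A \<^bold>+ B)"
| nf_pair: "nf \<L> f C A \<Longrightarrow> nf \<L> g C B \<Longrightarrow> nf \<L> ((f \<otimes> g) \<cdot> W C) C (A \<^bold>\<times> B)"
| nf_copair: "nf \<L> f A C \<Longrightarrow> nf \<L> g B C \<Longrightarrow> nf \<L> (M C \<cdot> (f \<oplus> g)) (A \<^bold>+ B) C"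

lemma nf_has_type: "nf \<L> f A B \<Longrightarrow> \<L> \<turnstile> f \<^bold>: A \<rightarrow> B"
  by (induction rule: nf.induct) (blast intro: typing dest: has_type_formulae)+

definition normalizable :: "'l set \<Rightarrow> 'l trm \<Rightarrow> 'l fm \<Rightarrow> 'l fm \<Rightarrow> bool" where
  "normalizable \<L> f A B \<longleftrightarrow> (\<exists>h. nf \<L> h A B \<and> \<L> \<turnstile> h \<approx> f \<^bold>: A \<rightarrow> B)"

lemma nf_imp_normalizable: "nf \<L> f A B \<Longrightarrow> normalizable \<L> f A B"
  unfolding normalizable_def by (blast intro: deq_refl nf_has_type)

lemma normalizable_has_type: "normalizable \<L> f A B \<Longrightarrow> \<L> \<turnstile> f \<^bold>: A \<rightarrow> B"
  unfolding normalizable_def by (blast dest: deq_has_type)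

lemma normalizable_deq:
  "normalizable \<L> f A B \<Longrightarrow> \<L> \<turnstile> f \<approx> g \<^bold>: A \<rightarrow> B \<Longrightarrow> normalizable \<L> g A B"
  unfolding normalizable_def by (blast intro: deq_trans)

lemma normalizable_K1:
  "normalizable \<L> f A C \<Longrightarrow> B \<in> formulae \<L> \<Longrightarrow> normalizable \<L> (f \<cdot> K1 A B) (A \<^bold>\<times> B) C"
  unfolding normalizable_def
  by (meson nf_K1 comp_right ty_K1 deq_has_type has_type_formulae)

lemma normalizable_K2:
  "normalizable \<L> f B C \<Longrightarrow> A \<in> formulae \<L> \<Longrightarrow> normalizable \<L> (f \<cdot> K2 A B) (A \<^bold>\<times> B) C"
  unfolding normalizable_def
  by (meson nf_K2 comp_right ty_K2 deq_has_type has_type_formulae)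

lemma normalizable_L1:
  "normalizable \<L> f C A \<Longrightarrow> B \<in> formulae \<L> \<Longrightarrow> normalizable \<L> (L1 A B \<cdot> f) C (A \<^bold>+ B)"
  unfolding normalizable_def
  by (meson nf_L1 comp_left ty_L1 deq_has_type has_type_formulae)

lemma normalizable_L2:
  "normalizable \<L> f C B \<Longrightarrow> A \<in> formulae \<L> \<Longrightarrow> normalizable \<L> (L2 A B \<cdot> f) C (A \<^bold>+ B)"
  unfolding normalizable_def
  by (meson nf_L2 comp_left ty_L2 deq_has_type has_type_formulae)

lemma normalizable_pair:
  "normalizable \<L> f C A \<Longrightarrow> normalizable \<L> g C B
    \<Longrightarrow> normalizable \<L> ((f \<otimes> g) \<cdot> W C) C (A \<^bold>\<times> B)"
  unfolding normalizable_def
  by (meson nf_pair comp_right cong_TTimes ty_W deq_has_type has_type_formulae)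

lemma normalizable_copair:
  "normalizable \<L> f A C \<Longrightarrow> normalizable \<L> g B C
    \<Longrightarrow> normalizable \<L> (M C \<cdot> (f \<oplus> g)) (A \<^bold>+ B) C"
  unfolding normalizable_def
  by (meson nf_copair comp_left cong_TPlus ty_M deq_has_type has_type_formulae)

text \<open>A term that composes to a normal form with every normal form ending in a right rule does
  so with all normal forms, since the left rules permute below the cut.\<close>

lemma normalizable_comp_left_rules:
  assumes "nf \<L> f A B" and g: "\<L> \<turnstile> g \<^bold>: B \<rightarrow> C"
    and Idt: "\<And>p. B = Letter p \<Longrightarrow> p \<in> \<L> \<Longrightarrow> normalizable \<L> (g \<cdot> Idt B) B C"
    and K: "\<And>A. B = FI \<Longrightarrow> A \<in> formulae \<L> \<Longrightarrow> normalizable \<L> (g \<cdot> K A) A C"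
    and L1: "\<And>f A B1 B2. B = B1 \<^bold>+ B2 \<Longrightarrow> nf \<L> f A B1
      \<Longrightarrow> normalizable \<L> (g \<cdot> (L1 B1 B2 \<cdot> f)) A C"
    and L2: "\<And>f A B1 B2. B = B1 \<^bold>+ B2 \<Longrightarrow> nf \<L> f A B2
      \<Longrightarrow> normalizable \<L> (g \<cdot> (L2 B1 B2 \<cdot> f)) A C"
    and pair: "\<And>f1 f2 A B1 B2. B = B1 \<^bold>\<times> B2 \<Longrightarrow> nf \<L> f1 A B1 \<Longrightarrow> nf \<L> f2 A B2
      \<Longrightarrow> normalizable \<L> (g \<cdot> ((f1 \<otimes> f2) \<cdot> W A)) A C"
  shows "normalizable \<L> (g \<cdot> f) A C"
  using assms
proof (induction rule: nf.induct)
  case (nf_L A)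
  then have "\<L> \<turnstile> g \<cdot> L A \<^bold>: FO \<rightarrow> C" "C \<in> formulae \<L>"
    using has_type_formulae by (blast intro: typing)+
  then show ?case
    by (blast intro: nf_imp_normalizable normalizable_deq nf.nf_L deq_sym L_unique)
next
  case (nf_K1 f A D B)
  then have f: "\<L> \<turnstile> f \<^bold>: A \<rightarrow> D" by (blast dest: nf_has_type)
  with nf_K1 have "\<L> \<turnstile> (g \<cdot> f) \<cdot> K1 A B \<approx> g \<cdot> (f \<cdot> K1 A B) \<^bold>: A \<^bold>\<times> B \<rightarrow> C"
    by (blast intro: comp_assoc typing dest: has_type_formulae)
  with nf_K1 show ?case by (blast intro: normalizable_deq normalizable_K1)
next
  case (nf_K2 f B D A)
  then have f: "\<L> \<turnstile> f \<^bold>: B \<rightarrow> D" by (blast dest: nf_has_type)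
  with nf_K2 have "\<L> \<turnstile> (g \<cdot> f) \<cdot> K2 A B \<approx> g \<cdot> (f \<cdot> K2 A B) \<^bold>: A \<^bold>\<times> B \<rightarrow> C"
    by (blast intro: comp_assoc typing dest: has_type_formulae)
  with nf_K2 show ?case by (blast intro: normalizable_deq normalizable_K2)
next
  \<comment> \<open>Permuting the cut below a copair duplicates \<open>g\<close>. This is harmless,
    since the induction runs on \<open>f\<close> with \<open>g\<close> fixed.\<close>
  case (nf_copair f1 A1 B f2 A2)
  have "normalizable \<L> (M C \<cdot> ((g \<cdot> f1) \<oplus> (g \<cdot> f2))) (A1 \<^bold>+ A2) C"
    using nf_copair by (blast intro: normalizable_copair)
  moreover have "\<L> \<turnstile> M C \<cdot> ((g \<cdot> f1) \<oplus> (g \<cdot> f2)) \<approx> g \<cdot> (M B \<cdot> (f1 \<oplus> f2)) \<^bold>: A1 \<^bold>+ A2 \<rightarrow> C"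
    using nf_copair by (blast intro: comp_copair nf_has_type)
  ultimately show ?case by (rule normalizable_deq)
qed blast+

text \<open>Structural induction on \<open>g\<close> with \<open>f\<close> arbitrary suffices,
  without a measure on the cut formula. Where a projection meets a pair, or a copair meets an
  injection, the cut collapses to one between a proper subterm of \<open>g\<close> and a normal
  form, and the induction hypothesis applies to any such normal form. Right rules at the end of
  \<open>g\<close> permute outwards.\<close>

lemma normalizable_comp_nf:
  assumes "nf \<L> g B C" and "nf \<L> f A B"
  shows "normalizable \<L> (g \<cdot> f) A C"
  using assms
proof (induction arbitrary: f A rule: nf.induct)
  case (nf_Idt p)
  then show ?case
    by (blast intro: nf_imp_normalizable normalizable_deq deq_sym id_left nf_has_type)
next
  case (nf_K B)
  then have "\<L> \<turnstile> K B \<cdot> f \<^bold>: A \<rightarrow> FI" "A \<in> formulae \<L>"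
    using nf_has_type has_type_formulae by (blast intro: typing)+
  then show ?case
    by (blast intro: nf_imp_normalizable normalizable_deq nf.nf_K deq_sym K_unique)
next
  case (nf_L C)
  \<comment> \<open>Neither a right rule nor \<open>Idt\<close> or \<open>K\<close> yields a normal
    form with target \<open>FO\<close>, so all five side conditions are vacuous.\<close>
  show ?case
    by (rule normalizable_comp_left_rules[OF nf_L.prems]) (use nf_L.hyps in \<open>auto intro: typing\<close>)
next
  case (nf_K1 g B1 C B2)
  have g: "\<L> \<turnstile> g \<^bold>: B1 \<rightarrow> C" and B1: "B1 \<in> formulae \<L>"
    using nf_K1 nf_has_type has_type_formulae by blast+
  have "normalizable \<L> ((g \<cdot> K1 B1 B2) \<cdot> ((f1 \<otimes> f2) \<cdot> W A)) A C"
    if "nf \<L> f1 A B1" "nf \<L> f2 A B2" for f1 f2 A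
  proof -
    have f: "\<L> \<turnstile> f1 \<^bold>: A \<rightarrow> B1" "\<L> \<turnstile> f2 \<^bold>: A \<rightarrow> B2" and A: "A \<in> formulae \<L>"
      using that nf_has_type has_type_formulae by blast+
    have "\<L> \<turnstile> g \<cdot> (K1 B1 B2 \<cdot> ((f1 \<otimes> f2) \<cdot> W A)) \<approx> (g \<cdot> K1 B1 B2) \<cdot> ((f1 \<otimes> f2) \<cdot> W A) \<^bold>: A \<rightarrow> C"
      using f g A B1 nf_K1.hyps by (blast intro: assoc typing)
    then have "\<L> \<turnstile> g \<cdot> f1 \<approx> (g \<cdot> K1 B1 B2) \<cdot> ((f1 \<otimes> f2) \<cdot> W A) \<^bold>: A \<rightarrow> C"
      by (rule deq_trans[OF comp_left[OF K1_pair[OF f, THEN deq_sym] g]])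
    with nf_K1.IH[OF that(1)] show ?thesis by (rule normalizable_deq)
  qed
  with g B1 nf_K1.hyps show ?case
    by (intro normalizable_comp_left_rules[OF nf_K1.prems]) (auto intro: typing)
next
  case (nf_K2 g B2 C B1)
  have g: "\<L> \<turnstile> g \<^bold>: B2 \<rightarrow> C" and B2: "B2 \<in> formulae \<L>"
    using nf_K2 nf_has_type has_type_formulae by blast+
  have "normalizable \<L> ((g \<cdot> K2 B1 B2) \<cdot> ((f1 \<otimes> f2) \<cdot> W A)) A C"
    if "nf \<L> f1 A B1" "nf \<L> f2 A B2" for f1 f2 A
  proof -
    have f: "\<L> \<turnstile> f1 \<^bold>: A \<rightarrow> B1" "\<L> \<turnstile> f2 \<^bold>: A \<rightarrow> B2" and A: "A \<in> formulae \<L>"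
      using that nf_has_type has_type_formulae by blast+
    have "\<L> \<turnstile> g \<cdot> (K2 B1 B2 \<cdot> ((f1 \<otimes> f2) \<cdot> W A)) \<approx> (g \<cdot> K2 B1 B2) \<cdot> ((f1 \<otimes> f2) \<cdot> W A) \<^bold>: A \<rightarrow> C"
      using f g A B2 nf_K2.hyps by (blast intro: assoc typing)
    then have "\<L> \<turnstile> g \<cdot> f2 \<approx> (g \<cdot> K2 B1 B2) \<cdot> ((f1 \<otimes> f2) \<cdot> W A) \<^bold>: A \<rightarrow> C"
      by (rule deq_trans[OF comp_left[OF K2_pair[OF f, THEN deq_sym] g]])
    with nf_K2.IH[OF that(2)] show ?thesis by (rule normalizable_deq)
  qed
  with g B2 nf_K2.hyps show ?case
    by (intro normalizable_comp_left_rules[OF nf_K2.prems]) (auto intro: typing)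
next
  case (nf_L1 g B C1 C2)
  then have "\<L> \<turnstile> L1 C1 C2 \<cdot> (g \<cdot> f) \<approx> (L1 C1 C2 \<cdot> g) \<cdot> f \<^bold>: A \<rightarrow> C1 \<^bold>+ C2"
    by (blast intro: assoc typing dest: nf_has_type has_type_formulae)
  with nf_L1 show ?case by (blast intro: normalizable_deq normalizable_L1)
next
  case (nf_L2 g B C2 C1)
  then have "\<L> \<turnstile> L2 C1 C2 \<cdot> (g \<cdot> f) \<approx> (L2 C1 C2 \<cdot> g) \<cdot> f \<^bold>: A \<rightarrow> C1 \<^bold>+ C2"
    by (blast intro: assoc typing dest: nf_has_type has_type_formulae)
  with nf_L2 show ?case by (blast intro: normalizable_deq normalizable_L2)
next
  case (nf_pair g1 B C1 g2 C2)
  have "normalizable \<L> (((g1 \<cdot> f) \<otimes> (g2 \<cdot> f)) \<cdot> W A) A (C1 \<^bold>\<times> C2)"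
    using nf_pair by (blast intro: normalizable_pair)
  moreover have "\<L> \<turnstile> ((g1 \<cdot> f) \<otimes> (g2 \<cdot> f)) \<cdot> W A \<approx> ((g1 \<otimes> g2) \<cdot> W B) \<cdot> f \<^bold>: A \<rightarrow> C1 \<^bold>\<times> C2"
    using nf_pair by (blast intro: pair_comp nf_has_type)
  ultimately show ?case by (rule normalizable_deq)
next
  case (nf_copair g1 B1 C g2 B2)
  have g: "\<L> \<turnstile> g1 \<^bold>: B1 \<rightarrow> C" "\<L> \<turnstile> g2 \<^bold>: B2 \<rightarrow> C"
    and fm: "B1 \<in> formulae \<L>" "B2 \<in> formulae \<L>" "C \<in> formulae \<L>"
    using nf_copair nf_has_type has_type_formulae by blast+
  have "normalizable \<L> ((M C \<cdot> (g1 \<oplus> g2)) \<cdot> (L1 B1 B2 \<cdot> f)) A C" if "nf \<L> f A B1" for f A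
  proof -
    have f: "\<L> \<turnstile> f \<^bold>: A \<rightarrow> B1" using that by (rule nf_has_type)
    have "\<L> \<turnstile> ((M C \<cdot> (g1 \<oplus> g2)) \<cdot> L1 B1 B2) \<cdot> f \<approx> (M C \<cdot> (g1 \<oplus> g2)) \<cdot> (L1 B1 B2 \<cdot> f) \<^bold>: A \<rightarrow> C"
      using f g fm by (blast intro: comp_assoc typing)
    then have "\<L> \<turnstile> g1 \<cdot> f \<approx> (M C \<cdot> (g1 \<oplus> g2)) \<cdot> (L1 B1 B2 \<cdot> f) \<^bold>: A \<rightarrow> C"
      by (rule deq_trans[OF comp_right[OF copair_L1[OF g, THEN deq_sym] f]])
    with nf_copair.IH(1)[OF that] show ?thesis by (rule normalizable_deq)
  qed
  moreover have "normalizable \<L> ((M C \<cdot> (g1 \<oplus> g2)) \<cdot> (L2 B1 B2 \<cdot> f)) A C" if "nf \<L> f A B2" for f A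
  proof -
    have f: "\<L> \<turnstile> f \<^bold>: A \<rightarrow> B2" using that by (rule nf_has_type)
    have "\<L> \<turnstile> ((M C \<cdot> (g1 \<oplus> g2)) \<cdot> L2 B1 B2) \<cdot> f \<approx> (M C \<cdot> (g1 \<oplus> g2)) \<cdot> (L2 B1 B2 \<cdot> f) \<^bold>: A \<rightarrow> C"
      using f g fm by (blast intro: comp_assoc typing)
    then have "\<L> \<turnstile> g2 \<cdot> f \<approx> (M C \<cdot> (g1 \<oplus> g2)) \<cdot> (L2 B1 B2 \<cdot> f) \<^bold>: A \<rightarrow> C"
      by (rule deq_trans[OF comp_right[OF copair_L2[OF g, THEN deq_sym] f]])
    with nf_copair.IH(2)[OF that] show ?thesis by (rule normalizable_deq)
  qed
  ultimately show ?case
    using g fm by (intro normalizable_comp_left_rules[OF nf_copair.prems]) (auto intro: typing)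
qed

lemma normalizable_comp:
  assumes "normalizable \<L> g B C" and "normalizable \<L> f A B"
  shows "normalizable \<L> (g \<cdot> f) A C"
proof -
  obtain f' g' where "nf \<L> g' B C" "nf \<L> f' A B"
    and "\<L> \<turnstile> g' \<approx> g \<^bold>: B \<rightarrow> C" "\<L> \<turnstile> f' \<approx> f \<^bold>: A \<rightarrow> B"
    using assms unfolding normalizable_def by blast
  then show ?thesis by (blast intro: normalizable_deq normalizable_comp_nf cong_Comp)
qed

lemma normalizable_TTimes:
  assumes "normalizable \<L> f A B" and "normalizable \<L> g C D"
  shows "normalizable \<L> (f \<otimes> g) (A \<^bold>\<times> C) (B \<^bold>\<times> D)"
proof -
  have ty: "\<L> \<turnstile> f \<^bold>: A \<rightarrow> B" "\<L> \<turnstile> g \<^bold>: C \<rightarrow> D"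
    using assms by (auto dest: normalizable_has_type)
  then have "A \<in> formulae \<L>" "C \<in> formulae \<L>" using has_type_formulae by blast+
  then show ?thesis
    using assms
    by (blast intro: normalizable_deq[OF _ pair_projections[OF ty]]
        normalizable_pair normalizable_K1 normalizable_K2)
qed

lemma normalizable_TPlus:
  assumes "normalizable \<L> f A B" and "normalizable \<L> g C D"
  shows "normalizable \<L> (f \<oplus> g) (A \<^bold>+ C) (B \<^bold>+ D)"
proof -
  have ty: "\<L> \<turnstile> f \<^bold>: A \<rightarrow> B" "\<L> \<turnstile> g \<^bold>: C \<rightarrow> D"
    using assms by (auto dest: normalizable_has_type)
  then have "B \<in> formulae \<L>" "D \<in> formulae \<L>" using has_type_formulae by blast+
  then show ?thesis
    using assms
    by (blast intro: normalizable_deq[OF _ copair_injections[OF ty]]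
        normalizable_copair normalizable_L1 normalizable_L2)
qed

text \<open>Identities on compound formulae are expanded down to letters, with the identities of I
  and O replaced by \<open>K FI\<close> and \<open>L FO\<close>.\<close>

lemma normalizable_Idt: "A \<in> formulae \<L> \<Longrightarrow> normalizable \<L> (Idt A) A A"
proof (induction rule: formulae.induct)
  case (1 p)
  then show ?case by (blast intro: nf_imp_normalizable nf_Idt)
next
  case 2
  show ?case
    by (blast intro: nf_imp_normalizable normalizable_deq nf_K deq_sym K_unique typing)
next
  case 3
  show ?case
    by (blast intro: nf_imp_normalizable normalizable_deq nf_L deq_sym L_unique typing)
next
  case (4 A B)
  then show ?case by (blast intro: normalizable_deq normalizable_TTimes times_id)
next
  case (5 A B)
  then show ?case by (blast intro: normalizable_deq normalizable_TPlus plus_id)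
qed

text \<open>Projections, injections, \<open>W\<close> and \<open>M\<close> are obtained by applying
  the corresponding rule of normal forms to expanded identities. Composition is the admissible
  cut.\<close>

lemma has_type_imp_normalizable: "\<L> \<turnstile> f \<^bold>: A \<rightarrow> B \<Longrightarrow> normalizable \<L> f A B"
proof (induction rule: has_type.induct)
  case (ty_K1 A B)
  then show ?case
    by (blast intro: normalizable_deq[OF normalizable_K1] normalizable_Idt id_left typing)
next
  case (ty_K2 A B)
  then show ?case
    by (blast intro: normalizable_deq[OF normalizable_K2] normalizable_Idt id_left typing)
next
  case (ty_L1 A B)
  then show ?case
    by (blast intro: normalizable_deq[OF normalizable_L1] normalizable_Idt id_right typing)
next
  case (ty_L2 A B)
  then show ?case
    by (blast intro: normalizable_deq[OF normalizable_L2] normalizable_Idt id_right typing)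
next
  case (ty_W A)
  have "\<L> \<turnstile> \<langle>A, A \<^bold>\<times> A\<rangle> (Idt A \<otimes> Idt A) \<cdot> W A \<simeq> Idt (A \<^bold>\<times> A) \<cdot> W A"
    unfolding hom_eq_def using ty_W by (blast intro: comp_right times_id typing)
  also have "\<L> \<turnstile> \<langle>A, A \<^bold>\<times> A\<rangle> \<dots> \<simeq> W A"
    unfolding hom_eq_def using ty_W by (blast intro: id_left typing)
  finally show ?case
    using ty_W unfolding hom_eq_def
    by (blast intro: normalizable_deq normalizable_pair normalizable_Idt)
next
  case (ty_M A)
  have "\<L> \<turnstile> \<langle>A \<^bold>+ A, A\<rangle> M A \<cdot> (Idt A \<oplus> Idt A) \<simeq> M A \<cdot> Idt (A \<^bold>+ A)"
    unfolding hom_eq_def using ty_M by (blast intro: comp_left plus_id typing)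
  also have "\<L> \<turnstile> \<langle>A \<^bold>+ A, A\<rangle> \<dots> \<simeq> M A"
    unfolding hom_eq_def using ty_M by (blast intro: id_right typing)
  finally show ?case
    using ty_M unfolding hom_eq_def
    by (blast intro: normalizable_deq normalizable_copair normalizable_Idt)
qed (blast intro: nf_imp_normalizable nf_K nf_L normalizable_Idt normalizable_comp
    normalizable_TTimes normalizable_TPlus)+

section \<open>Arrows that factor through O or through I\<close>

text \<open>Only \<open>u\<close> is left to choose: the second factor can be fixed as
  \<open>L B\<close>, since every arrow from O to \<open>B\<close> equals it. For factoring through
  I it is the first factor that is forced.\<close>

definition via_FO :: "'l set \<Rightarrow> 'l trm \<Rightarrow> 'l fm \<Rightarrow> 'l fm \<Rightarrow> bool" where
  "via_FO \<L> f A B \<longleftrightarrow> (\<exists>u. \<L> \<turnstile> u \<^bold>: A \<rightarrow> FO \<and> \<L> \<turnstile> f \<approx> L B \<cdot> u \<^bold>: A \<rightarrow> B)"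

definition via_FI :: "'l set \<Rightarrow> 'l trm \<Rightarrow> 'l fm \<Rightarrow> 'l fm \<Rightarrow> bool" where
  "via_FI \<L> f A B \<longleftrightarrow> (\<exists>v. \<L> \<turnstile> v \<^bold>: FI \<rightarrow> B \<and> \<L> \<turnstile> f \<approx> v \<cdot> K A \<^bold>: A \<rightarrow> B)"

lemma comp_L:
  assumes "\<L> \<turnstile> u \<^bold>: A \<rightarrow> FO" and "\<L> \<turnstile> h \<^bold>: B \<rightarrow> C"
  shows "\<L> \<turnstile> h \<cdot> (L B \<cdot> u) \<approx> L C \<cdot> u \<^bold>: A \<rightarrow> C"
proof -
  have B: "B \<in> formulae \<L>" using assms has_type_formulae by blast
  have "\<L> \<turnstile> \<langle>A, C\<rangle> h \<cdot> (L B \<cdot> u) \<simeq> (h \<cdot> L B) \<cdot> u"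
    unfolding hom_eq_def using assms B by (blast intro: assoc typing)
  also have "\<L> \<turnstile> \<langle>A, C\<rangle> \<dots> \<simeq> L C \<cdot> u"
    unfolding hom_eq_def using assms B by (blast intro: comp_right L_unique typing)
  finally show ?thesis unfolding hom_eq_def .
qed

lemma K_comp:
  assumes "\<L> \<turnstile> v \<^bold>: FI \<rightarrow> C" and "\<L> \<turnstile> h \<^bold>: A \<rightarrow> B"
  shows "\<L> \<turnstile> (v \<cdot> K B) \<cdot> h \<approx> v \<cdot> K A \<^bold>: A \<rightarrow> C"
proof -
  have B: "B \<in> formulae \<L>" using assms has_type_formulae by blast
  have "\<L> \<turnstile> \<langle>A, C\<rangle> (v \<cdot> K B) \<cdot> h \<simeq> v \<cdot> (K B \<cdot> h)"
    unfolding hom_eq_def using assms B by (blast intro: comp_assoc typing)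
  also have "\<L> \<turnstile> \<langle>A, C\<rangle> \<dots> \<simeq> v \<cdot> K A"
    unfolding hom_eq_def using assms B by (blast intro: comp_left K_unique typing)
  finally show ?thesis unfolding hom_eq_def .
qed

text \<open>Both sides equal the composite A -> O -> I -> B of \<open>u\<close>, \<open>L FI\<close>
  and \<open>v\<close>: its last two arrows make up an arrow out of O, and its first two an arrow
  into I. Hence one arrow from \<open>A\<close> to O turns every factorization through I into one
  through O, and dually.\<close>

lemma L_K:
  assumes u: "\<L> \<turnstile> u \<^bold>: A \<rightarrow> FO" and v: "\<L> \<turnstile> v \<^bold>: FI \<rightarrow> B"
  shows "\<L> \<turnstile> L B \<cdot> u \<approx> v \<cdot> K A \<^bold>: A \<rightarrow> B"
proof -
  have "\<L> \<turnstile> L FI \<cdot> u \<approx> K A \<^bold>: A \<rightarrow> FI" using u by (blast intro: K_unique typing)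
  from deq_trans[OF deq_sym[OF comp_L[OF u v]] comp_left[OF this v]] show ?thesis .
qed

lemma via_FO_comp:
  assumes "via_FO \<L> g B C" and h: "\<L> \<turnstile> h \<^bold>: A \<rightarrow> B"
  shows "via_FO \<L> (g \<cdot> h) A C"
proof -
  from assms obtain u where u: "\<L> \<turnstile> u \<^bold>: B \<rightarrow> FO" and g: "\<L> \<turnstile> g \<approx> L C \<cdot> u \<^bold>: B \<rightarrow> C"
    unfolding via_FO_def by blast
  have C: "C \<in> formulae \<L>" using g deq_has_type has_type_formulae by blast
  have "\<L> \<turnstile> \<langle>A, C\<rangle> g \<cdot> h \<simeq> (L C \<cdot> u) \<cdot> h"
    unfolding hom_eq_def using g h by (rule comp_right)
  also have "\<L> \<turnstile> \<langle>A, C\<rangle> \<dots> \<simeq> L C \<cdot> (u \<cdot> h)"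
    unfolding hom_eq_def using u h C by (blast intro: comp_assoc typing)
  finally show ?thesis
    unfolding via_FO_def hom_eq_def using u h by (blast intro: typing)
qed

lemma comp_via_FI:
  assumes "via_FI \<L> f A B" and h: "\<L> \<turnstile> h \<^bold>: B \<rightarrow> C"
  shows "via_FI \<L> (h \<cdot> f) A C"
proof -
  from assms obtain v where v: "\<L> \<turnstile> v \<^bold>: FI \<rightarrow> B" and f: "\<L> \<turnstile> f \<approx> v \<cdot> K A \<^bold>: A \<rightarrow> B"
    unfolding via_FI_def by blast
  have A: "A \<in> formulae \<L>" using f deq_has_type has_type_formulae by blast
  have "\<L> \<turnstile> \<langle>A, C\<rangle> h \<cdot> f \<simeq> h \<cdot> (v \<cdot> K A)"
    unfolding hom_eq_def using f h by (rule comp_left)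
  also have "\<L> \<turnstile> \<langle>A, C\<rangle> \<dots> \<simeq> (h \<cdot> v) \<cdot> K A"
    unfolding hom_eq_def using v h A by (blast intro: assoc typing)
  finally show ?thesis
    unfolding via_FI_def hom_eq_def using v h by (blast intro: typing)
qed

lemma comp_via_FO:
  "via_FO \<L> f A B \<Longrightarrow> \<L> \<turnstile> h \<^bold>: B \<rightarrow> C \<Longrightarrow> via_FO \<L> (h \<cdot> f) A C"
  unfolding via_FO_def by (blast intro: comp_L comp_left deq_trans)

lemma via_FI_comp:
  "via_FI \<L> g B C \<Longrightarrow> \<L> \<turnstile> h \<^bold>: A \<rightarrow> B \<Longrightarrow> via_FI \<L> (g \<cdot> h) A C"
  unfolding via_FI_def by (blast intro: K_comp comp_right deq_trans)

lemma via_FI_imp_via_FO: "via_FI \<L> f A B \<Longrightarrow> \<L> \<turnstile> u \<^bold>: A \<rightarrow> FO \<Longrightarrow> via_FO \<L> f A B"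
  unfolding via_FI_def via_FO_def by (blast intro: deq_trans deq_sym[OF L_K])

lemma via_FO_imp_via_FI: "via_FO \<L> f A B \<Longrightarrow> \<L> \<turnstile> v \<^bold>: FI \<rightarrow> B \<Longrightarrow> via_FI \<L> f A B"
  unfolding via_FI_def via_FO_def by (blast intro: deq_trans L_K)

lemma via_FO_unique:
  assumes "via_FO \<L> f A B" and "via_FO \<L> g A B"
  shows "\<L> \<turnstile> f \<approx> g \<^bold>: A \<rightarrow> B"
proof -
  from assms obtain u u' where u: "\<L> \<turnstile> u \<^bold>: A \<rightarrow> FO" "\<L> \<turnstile> u' \<^bold>: A \<rightarrow> FO"
    and eq: "\<L> \<turnstile> f \<approx> L B \<cdot> u \<^bold>: A \<rightarrow> B" "\<L> \<turnstile> g \<approx> L B \<cdot> u' \<^bold>: A \<rightarrow> B"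
    unfolding via_FO_def by blast
  have "B \<in> formulae \<L>" using eq deq_has_type has_type_formulae by blast
  then have "\<L> \<turnstile> L B \<cdot> u \<approx> L B \<cdot> u' \<^bold>: A \<rightarrow> B"
    using u by (blast intro: comp_left into_FO_unique typing)
  with eq show ?thesis by (blast intro: deq_trans deq_sym)
qed

lemma via_FI_unique:
  assumes "via_FI \<L> f A B" and "via_FI \<L> g A B"
  shows "\<L> \<turnstile> f \<approx> g \<^bold>: A \<rightarrow> B"
proof -
  from assms obtain v v' where v: "\<L> \<turnstile> v \<^bold>: FI \<rightarrow> B" "\<L> \<turnstile> v' \<^bold>: FI \<rightarrow> B"
    and eq: "\<L> \<turnstile> f \<approx> v \<cdot> K A \<^bold>: A \<rightarrow> B" "\<L> \<turnstile> g \<approx> v' \<cdot> K A \<^bold>: A \<rightarrow> B"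
    unfolding via_FI_def by blast
  have "A \<in> formulae \<L>" using eq deq_has_type has_type_formulae by blast
  then have "\<L> \<turnstile> v \<cdot> K A \<approx> v' \<cdot> K A \<^bold>: A \<rightarrow> B"
    using v by (blast intro: comp_right from_FI_unique typing)
  with eq show ?thesis by (blast intro: deq_trans deq_sym)
qed

text \<open>If some arrow from \<open>A\<close> to O exists, both terms factor through O; otherwise
  neither does, and both factor through I. The mixed case thus never needs a comparison of its
  own.\<close>

lemma via_unique:
  assumes "via_FO \<L> f A B \<or> via_FI \<L> f A B" and "via_FO \<L> g A B \<or> via_FI \<L> g A B"
  shows "\<L> \<turnstile> f \<approx> g \<^bold>: A \<rightarrow> B"
proof (cases "\<exists>u. \<L> \<turnstile> u \<^bold>: A \<rightarrow> FO")
  case True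
  with assms show ?thesis by (blast intro: via_FO_unique via_FI_imp_via_FO)
next
  case False
  with assms show ?thesis unfolding via_FO_def by (blast intro: via_FI_unique)
qed

lemma via_FO_pair:
  assumes "via_FO \<L> f C A" and "via_FO \<L> g C B"
  shows "via_FO \<L> ((f \<otimes> g) \<cdot> W C) C (A \<^bold>\<times> B)"
proof -
  from assms obtain u where u: "\<L> \<turnstile> u \<^bold>: C \<rightarrow> FO"
    and f: "\<L> \<turnstile> f \<approx> L A \<cdot> u \<^bold>: C \<rightarrow> A"
    unfolding via_FO_def by blast
  have fm: "A \<in> formulae \<L>" "B \<in> formulae \<L>" "C \<in> formulae \<L>"
    using assms unfolding via_FO_def using deq_has_type has_type_formulae by blast+
  have "via_FO \<L> (L B \<cdot> u) C B"
    unfolding via_FO_def using u fm by (blast intro: deq_refl typing)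
  then have g: "\<L> \<turnstile> g \<approx> L B \<cdot> u \<^bold>: C \<rightarrow> B" by (rule via_FO_unique[OF assms(2)])
  have "\<L> \<turnstile> \<langle>C, A \<^bold>\<times> B\<rangle> (f \<otimes> g) \<cdot> W C \<simeq> ((L A \<cdot> u) \<otimes> (L B \<cdot> u)) \<cdot> W C"
    unfolding hom_eq_def using f g fm by (blast intro: comp_right cong_TTimes typing)
  also have "\<L> \<turnstile> \<langle>C, A \<^bold>\<times> B\<rangle> \<dots> \<simeq> ((L A \<otimes> L B) \<cdot> W FO) \<cdot> u"
    unfolding hom_eq_def using u fm by (blast intro: pair_comp typing)
  also have "\<L> \<turnstile> \<langle>C, A \<^bold>\<times> B\<rangle> \<dots> \<simeq> L (A \<^bold>\<times> B) \<cdot> u"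
    unfolding hom_eq_def using u fm by (blast intro: comp_right L_unique typing)
  finally show ?thesis unfolding via_FO_def hom_eq_def using u by blast
qed

lemma via_FI_pair:
  assumes "via_FI \<L> f C A" and "via_FI \<L> g C B"
  shows "via_FI \<L> ((f \<otimes> g) \<cdot> W C) C (A \<^bold>\<times> B)"
proof -
  from assms obtain v v' where v: "\<L> \<turnstile> v \<^bold>: FI \<rightarrow> A" "\<L> \<turnstile> v' \<^bold>: FI \<rightarrow> B"
    and eq: "\<L> \<turnstile> f \<approx> v \<cdot> K C \<^bold>: C \<rightarrow> A" "\<L> \<turnstile> g \<approx> v' \<cdot> K C \<^bold>: C \<rightarrow> B"
    unfolding via_FI_def by blast
  have C: "C \<in> formulae \<L>" using eq deq_has_type has_type_formulae by blast
  have "\<L> \<turnstile> \<langle>C, A \<^bold>\<times> B\<rangle> (f \<otimes> g) \<cdot> W C \<simeq> ((v \<cdot> K C) \<otimes> (v' \<cdot> K C)) \<cdot> W C"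
    unfolding hom_eq_def using eq C by (blast intro: comp_right cong_TTimes typing)
  also have "\<L> \<turnstile> \<langle>C, A \<^bold>\<times> B\<rangle> \<dots> \<simeq> ((v \<otimes> v') \<cdot> W FI) \<cdot> K C"
    unfolding hom_eq_def using v C by (blast intro: pair_comp typing)
  finally show ?thesis unfolding via_FI_def hom_eq_def using v by (blast intro: typing)
qed

lemma via_FI_copair:
  assumes "via_FI \<L> f A C" and "via_FI \<L> g B C"
  shows "via_FI \<L> (M C \<cdot> (f \<oplus> g)) (A \<^bold>+ B) C"
proof -
  from assms obtain v where v: "\<L> \<turnstile> v \<^bold>: FI \<rightarrow> C"
    and f: "\<L> \<turnstile> f \<approx> v \<cdot> K A \<^bold>: A \<rightarrow> C"
    unfolding via_FI_def by blast
  have fm: "A \<in> formulae \<L>" "B \<in> formulae \<L>" "C \<in> formulae \<L>"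
    using assms unfolding via_FI_def using deq_has_type has_type_formulae by blast+
  have "via_FI \<L> (v \<cdot> K B) B C"
    unfolding via_FI_def using v fm by (blast intro: deq_refl typing)
  then have g: "\<L> \<turnstile> g \<approx> v \<cdot> K B \<^bold>: B \<rightarrow> C" by (rule via_FI_unique[OF assms(2)])
  have "\<L> \<turnstile> \<langle>A \<^bold>+ B, C\<rangle> M C \<cdot> (f \<oplus> g) \<simeq> M C \<cdot> ((v \<cdot> K A) \<oplus> (v \<cdot> K B))"
    unfolding hom_eq_def using f g fm by (blast intro: comp_left cong_TPlus typing)
  also have "\<L> \<turnstile> \<langle>A \<^bold>+ B, C\<rangle> \<dots> \<simeq> v \<cdot> (M FI \<cdot> (K A \<oplus> K B))"
    unfolding hom_eq_def using v fm by (blast intro: comp_copair typing)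
  also have "\<L> \<turnstile> \<langle>A \<^bold>+ B, C\<rangle> \<dots> \<simeq> v \<cdot> K (A \<^bold>+ B)"
    unfolding hom_eq_def using v fm by (blast intro: comp_left K_unique typing)
  finally show ?thesis unfolding via_FI_def hom_eq_def using v by blast
qed

lemma via_FO_copair:
  assumes "via_FO \<L> f A C" and "via_FO \<L> g B C"
  shows "via_FO \<L> (M C \<cdot> (f \<oplus> g)) (A \<^bold>+ B) C"
proof -
  from assms obtain u u' where u: "\<L> \<turnstile> u \<^bold>: A \<rightarrow> FO" "\<L> \<turnstile> u' \<^bold>: B \<rightarrow> FO"
    and eq: "\<L> \<turnstile> f \<approx> L C \<cdot> u \<^bold>: A \<rightarrow> C" "\<L> \<turnstile> g \<approx> L C \<cdot> u' \<^bold>: B \<rightarrow> C"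
    unfolding via_FO_def by blast
  have C: "C \<in> formulae \<L>" using eq deq_has_type has_type_formulae by blast
  have "\<L> \<turnstile> \<langle>A \<^bold>+ B, C\<rangle> M C \<cdot> (f \<oplus> g) \<simeq> M C \<cdot> ((L C \<cdot> u) \<oplus> (L C \<cdot> u'))"
    unfolding hom_eq_def using eq C by (blast intro: comp_left cong_TPlus typing)
  also have "\<L> \<turnstile> \<langle>A \<^bold>+ B, C\<rangle> \<dots> \<simeq> L C \<cdot> (M FO \<cdot> (u \<oplus> u'))"
    unfolding hom_eq_def using u C by (blast intro: comp_copair typing)
  finally show ?thesis unfolding via_FO_def hom_eq_def using u by (blast intro: typing)
qed

section \<open>From an empty graph to a factorization\<close>

lemma nf_empty_via:
  assumes "nf \<L> f A B" and "G f = {}"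
  shows "via_FO \<L> f A B \<or> via_FI \<L> f A B"
  using assms
proof (induction rule: nf.induct)
  case (nf_Idt p)
  \<comment> \<open>The identity on a letter relates 0 to 0, so its graph is not empty.\<close>
  then show ?case by simp
next
  case (nf_K A)
  then have "via_FI \<L> (K A) A FI"
    unfolding via_FI_def by (blast intro: deq_sym id_left typing)
  then show ?case ..
next
  case (nf_L A)
  then have "via_FO \<L> (L A) FO A"
    unfolding via_FO_def by (blast intro: deq_sym id_right typing)
  then show ?case ..
next
  case (nf_K1 f A C B)
  have f: "\<L> \<turnstile> f \<^bold>: A \<rightarrow> C" using nf_K1.hyps by (blast dest: nf_has_type)
  \<comment> \<open>Every pair in the graph of \<open>f\<close> starts inside the block of
    \<open>A\<close>, on which the projection is the identity relation; composing therefore loses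
    nothing. The other projection and the injections behave in the same way, up to a shift.\<close>
  with nf_K1.prems have "G f = {}" by (auto dest: G_bound)
  with nf_K1 f show ?case
    by (blast intro: via_FO_comp via_FI_comp typing dest: has_type_formulae)
next
  case (nf_K2 f B C A)
  have f: "\<L> \<turnstile> f \<^bold>: B \<rightarrow> C" using nf_K2.hyps by (blast dest: nf_has_type)
  with nf_K2.prems have "G f = {}" by (auto dest: G_bound)
  with nf_K2 f show ?case
    by (blast intro: via_FO_comp via_FI_comp typing dest: has_type_formulae)
next
  case (nf_L1 f C A B)
  have f: "\<L> \<turnstile> f \<^bold>: C \<rightarrow> A" using nf_L1.hyps by (blast dest: nf_has_type)
  with nf_L1.prems have "G f = {}" by (auto dest: G_bound)
  with nf_L1 f show ?case
    by (blast intro: comp_via_FO comp_via_FI typing dest: has_type_formulae)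
next
  case (nf_L2 f C B A)
  have f: "\<L> \<turnstile> f \<^bold>: C \<rightarrow> B" using nf_L2.hyps by (blast dest: nf_has_type)
  with nf_L2.prems have "G f = {}" by (auto dest: G_bound)
  with nf_L2 f show ?case
    by (blast intro: comp_via_FO comp_via_FI typing dest: has_type_formulae)
next
  case (nf_pair f C A g B)
  have ty: "\<L> \<turnstile> f \<^bold>: C \<rightarrow> A" "\<L> \<turnstile> g \<^bold>: C \<rightarrow> B"
    using nf_pair.hyps by (auto dest: nf_has_type)
  \<comment> \<open>Projecting the pair recovers each component up to equality, hence with the same
    graph, and composing an empty relation with a projection gives the empty relation.\<close>
  have "G f = {}" "G g = {}"
    using deq_imp_G_eq[OF K1_pair[OF ty]] deq_imp_G_eq[OF K2_pair[OF ty]] nf_pair.prems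
    by auto
  then have via: "via_FO \<L> f C A \<or> via_FI \<L> f C A" "via_FO \<L> g C B \<or> via_FI \<L> g C B"
    using nf_pair.IH by auto
  show ?case
  \<comment> \<open>The components may factor through different constants. An arrow from
    \<open>C\<close> to O moves both to O; without one, both already factor through I.\<close>
  proof (cases "\<exists>u. \<L> \<turnstile> u \<^bold>: C \<rightarrow> FO")
    case True
    with via show ?thesis by (blast intro: via_FO_pair via_FI_imp_via_FO)
  next
    case False
    with via show ?thesis unfolding via_FO_def by (blast intro: via_FI_pair)
  qed
next
  case (nf_copair f A C g B)
  have ty: "\<L> \<turnstile> f \<^bold>: A \<rightarrow> C" "\<L> \<turnstile> g \<^bold>: B \<rightarrow> C"
    using nf_copair.hyps by (auto dest: nf_has_type)
  have "G f = {}" "G g = {}"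
    using deq_imp_G_eq[OF copair_L1[OF ty]] deq_imp_G_eq[OF copair_L2[OF ty]] nf_copair.prems
    by auto
  then have via: "via_FO \<L> f A C \<or> via_FI \<L> f A C" "via_FO \<L> g B C \<or> via_FI \<L> g B C"
    using nf_copair.IH by auto
  show ?case
  \<comment> \<open>For copairs the shared object is the target, so an arrow from I to
    \<open>C\<close> decides.\<close>
  proof (cases "\<exists>v. \<L> \<turnstile> v \<^bold>: FI \<rightarrow> C")
    case True
    with via show ?thesis by (blast intro: via_FI_copair via_FO_imp_via_FI)
  next
    case False
    with via show ?thesis unfolding via_FI_def by (blast intro: via_FO_copair)
  qed
qed

text \<open>Emptiness of the graph and factoring through O or I are both invariant under equality,
  so the result for the normal form passes to \<open>f\<close>.\<close>

lemma empty_via: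
  assumes "\<L> \<turnstile> f \<^bold>: A \<rightarrow> B" and "G f = {}"
  shows "via_FO \<L> f A B \<or> via_FI \<L> f A B"
proof -
  obtain h where h: "nf \<L> h A B" and eq: "\<L> \<turnstile> h \<approx> f \<^bold>: A \<rightarrow> B"
    using has_type_imp_normalizable[OF assms(1)] unfolding normalizable_def by blast
  have "via_FO \<L> h A B \<or> via_FI \<L> h A B"
    using nf_empty_via[OF h] deq_imp_G_eq[OF eq] assms(2) by simp
  then show ?thesis
    unfolding via_FO_def via_FI_def using eq by (blast intro: deq_trans deq_sym)
qed

theorem mainTheorem2:
  fixes \<L> :: "'l set" and A B :: "'l fm" and f g :: "'l trm"
  assumes "\<L> \<turnstile> f \<^bold>: A \<rightarrow> B" and "\<L> \<turnstile> g \<^bold>: A \<rightarrow> B"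
    and "G f = {}" and "G g = {}"
  shows "\<L> \<turnstile> f \<approx> g \<^bold>: A \<rightarrow> B"
  using empty_via[OF assms(1,3)] empty_via[OF assms(2,4)] by (rule via_unique)

end
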